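(* Let $\mathcal{I}=(V,E,[q],\Phi)$ be a graphical model and $(D,\Phi_D)$ an update to $\mathcal{I}$ producing $\mathcal{I}'=(V,E',[q],\Phi')$. Assume that for every $e\in E'$ we have $\phi'_e:[q]^e\to[B_e,1]$ for some $0<B_e\le1$, and that there is a constant $0<\delta<1$ such that for all $e\in E'$, $B_e\ge\left(1-\frac{1-\delta}{d+1}\right)^{1/2}$, where $d\triangleq\max_{e\in E}|\Gamma(e)|$ is the maximum degree of the dependency graph of $\mathcal{I}'$. Then the Dynamic Sampler (run on $\mathcal{I}$, a sample $\boldsymbol{X}$, and the update $(D,\Phi_D)$) terminates within $O(\log|D|)$ iterations of its while loop in expectation. Further, if $d=O(1)$ and $\max_{e\in E}|e|=O(1)$, the total number of resamplings is bounded by $O(|D|)$ in expectation.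
   Context: A graphical model is $\mathcal{I}=(V,E,[q],\Phi)$: $V$ finite set of variables with domain $[q]$; $E\subseteq2^V$ constraints with $|e|>1$; $\phi_v:[q]\to\mathbb{R}_{\ge0}$ a probability distribution for each $v\in V$, $\phi_e:[q]^e\to[0,1]$ for each $e\in E$. Gibbs distribution $\mu_{\mathcal{I}}(\sigma)\propto\prod_v\phi_v(\sigma_v)\prod_e\phi_e(\sigma_e)$. The dependency graph has vertex set $E$, with $e,f$ adjacent iff $e\cap f\neq\emptyset$; $\Gamma(e)=\{f\in E\setminus\{e\}: f\cap e\neq\emptyset\}$. For $S\subseteq V$: $E(S)=\{e:e\subseteq S\}$, $\delta(S)=\{e:e\not\subseteq S,e\cap S\ne\emptyset\}$, $E^+(S)=E(S)\cup\delta(S)$; $\mathrm{vbl}(D)$ is the set of variables in $D$ together with all variables of constraints in $D$. An update $(D,\Phi_D)$: $D$ consists of variables, existing constraints, or new constraints $e\subseteq V$ with $|e|>1$, and $\Phi_D$ gives their new functions; applying it yields $\mathcal{I}'$. Local-Resample$(\mathcal{I},\boldsymbol{X},\mathcal{R})$: for each $e\in E^+(\mathcal{R})$ compute $\kappa_e=\frac{1}{\phi_e(X_e)}\min_{x\in[q]^e:x_{e\cap\mathcal{R}}=X_{e\cap\mathcal{R}}}\phi_e(x)$ (with $0/0=1$) from the current $\boldsymbol{X}$; resample each $X_v$, $v\in\mathcal{R}$, independently from $\phi_v$; for each $e\in E^+(\mathcal{R})$ independently draw $F_e\in\{0,1\}$ with $\Pr[F_e=0]=\kappa_e\phi_e(X_e)$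 evaluated at the resampled $X$; return $(\boldsymbol{X},\bigcup_{e:F_e=1}e)$. Dynamic Sampler: $\mathcal{R}\gets\mathrm{vbl}(D)$; while $\mathcal{R}\ne\emptyset$, $(\boldsymbol{X},\mathcal{R})\gets$ Local-Resample$(\mathcal{I}',\boldsymbol{X},\mathcal{R})$; return $\boldsymbol{X}$. The number of resamplings is the total number of individual samplings of values $X_v\in[q]$ and indicators $F_e\in\{0,1\}$ performed during the execution. *)

theory Defs
  imports "HOL-Probability.SPMF" "HOL-Probability.Product_PMF"
begin

record 'v graphical_model =
  gm_vars :: "'v set"
  gm_cons :: "'v set set"
  gm_q :: nat
  gm_phi_v :: "'v \<Rightarrow> nat pmf"
  gm_phi_c :: "'v set \<Rightarrow> ('v \<Rightarrow> nat) \<Rightarrow> real"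

definition assignments :: "'v graphical_model \<Rightarrow> 'v set \<Rightarrow> ('v \<Rightarrow> nat) set" where
  "assignments I S = S \<rightarrow>\<^sub>E {1..gm_q I}"

definition is_graphical_model :: "'v graphical_model \<Rightarrow> bool" where
  "is_graphical_model I \<longleftrightarrow>
     finite (gm_vars I) \<and>
     (\<forall>e\<in>gm_cons I. e \<subseteq> gm_vars I \<and> 1 < card e) \<and>
     (\<forall>v\<in>gm_vars I. set_pmf (gm_phi_v I v) \<subseteq> {1..gm_q I}) \<and>
     (\<forall>e\<in>gm_cons I. \<forall>x\<in>assignments I e. gm_phi_c I e x \<in> {0..1})"

definition weight :: "'v graphical_model \<Rightarrow> ('v \<Rightarrow> nat) \<Rightarrow> real" where
  "weight I \<sigma> = (\<Prod>v\<in>gm_vars I. pmf (gm_phi_v I v) (\<sigma> v)) *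
     (\<Prod>e\<in>gm_cons I. gm_phi_c I e (restrict \<sigma> e))"

text \<open>If all weights vanish, the Gibbs distribution does not exist, and indeed no
  \<open>\<mu>\<close> satisfies the following predicate, since a pmf is not identically zero.\<close>

definition is_gibbs :: "'v graphical_model \<Rightarrow> ('v \<Rightarrow> nat) pmf \<Rightarrow> bool" where
  "is_gibbs I \<mu> \<longleftrightarrow> (\<forall>\<sigma>. pmf \<mu> \<sigma> =
     (if \<sigma> \<in> assignments I (gm_vars I)
      then weight I \<sigma> / (\<Sum>\<tau>\<in>assignments I (gm_vars I). weight I \<tau>) else 0))"

definition dep_neighbours :: "'v graphical_model \<Rightarrow> 'v set \<Rightarrow> 'v set set" where
  "dep_neighbours I e = {f \<in> gm_cons I - {e}. f \<inter> e \<noteq> {}}"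

text \<open>The maximum over an empty set of constraints is taken to be \<open>0\<close>.\<close>

definition max_dep_degree :: "'v graphical_model \<Rightarrow> nat" where
  "max_dep_degree I = Max (insert 0 ((\<lambda>e. card (dep_neighbours I e)) ` gm_cons I))"

definition internal_cons :: "'v graphical_model \<Rightarrow> 'v set \<Rightarrow> 'v set set" where
  "internal_cons I S = {e \<in> gm_cons I. e \<subseteq> S}"

definition boundary_cons :: "'v graphical_model \<Rightarrow> 'v set \<Rightarrow> 'v set set" where
  "boundary_cons I S = {e \<in> gm_cons I. \<not> e \<subseteq> S \<and> e \<inter> S \<noteq> {}}"

definition incident_cons :: "'v graphical_model \<Rightarrow> 'v set \<Rightarrow> 'v set set" where
  "incident_cons I S = internal_cons I S \<union> boundary_cons I S"

text \<open>In an update \<open>(D, \<Phi>\<^sub>D)\<close>, the set \<open>D\<close> contains variables (\<open>Inl\<close>) and constraints (\<open>Inr\<close>);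
  the two function fields are relevant only on \<open>D\<close>.\<close>

record 'v gm_update =
  upd_set :: "('v + 'v set) set"
  upd_phi_v :: "'v \<Rightarrow> nat pmf"
  upd_phi_c :: "'v set \<Rightarrow> ('v \<Rightarrow> nat) \<Rightarrow> real"

text \<open>Existing constraints already satisfy the condition imposed on the constraints in \<open>D\<close>.\<close>

definition is_update :: "'v graphical_model \<Rightarrow> 'v gm_update \<Rightarrow> bool" where
  "is_update I U \<longleftrightarrow>
     (\<forall>v. Inl v \<in> upd_set U \<longrightarrow>
        v \<in> gm_vars I \<and> set_pmf (upd_phi_v U v) \<subseteq> {1..gm_q I}) \<and>
     (\<forall>e. Inr e \<in> upd_set U \<longrightarrow>
        e \<subseteq> gm_vars I \<and> 1 < card e \<and>
        (\<forall>x\<in>assignments I e. upd_phi_c U e x \<in> {0..1}))"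

definition apply_update :: "'v graphical_model \<Rightarrow> 'v gm_update \<Rightarrow> 'v graphical_model" where
  "apply_update I U =
     \<lparr> gm_vars = gm_vars I,
       gm_cons = gm_cons I \<union> {e. Inr e \<in> upd_set U},
       gm_q = gm_q I,
       gm_phi_v = (\<lambda>v. if Inl v \<in> upd_set U then upd_phi_v U v else gm_phi_v I v),
       gm_phi_c = (\<lambda>e. if Inr e \<in> upd_set U then upd_phi_c U e else gm_phi_c I e) \<rparr>"

definition vbl :: "('v + 'v set) set \<Rightarrow> 'v set" where
  "vbl D = {v. Inl v \<in> D} \<union> \<Union>{e. Inr e \<in> D}"

text \<open>The convention \<open>0/0 = 1\<close> is made explicit.\<close>

definition kappa :: "'v graphical_model \<Rightarrow> ('v \<Rightarrow> nat) \<Rightarrow> 'v set \<Rightarrow> 'v set \<Rightarrow> real" where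
  "kappa I X R e =
     (let m = Min (gm_phi_c I e `
                {x \<in> assignments I e. restrict x (e \<inter> R) = restrict X (e \<inter> R)});
          p = gm_phi_c I e (restrict X e)
      in if m = 0 \<and> p = 0 then 1 else m / p)"

text \<open>\<open>F e = True\<close> encodes \<open>F\<^sub>e = 1\<close>.  The factor \<open>kappa\<close> refers to the old configuration \<open>X\<close>,
  the constraint function to the resampled configuration \<open>X'\<close>.\<close>

definition local_resample ::
    "'v graphical_model \<Rightarrow> ('v \<Rightarrow> nat) \<Rightarrow> 'v set \<Rightarrow> (('v \<Rightarrow> nat) \<times> 'v set) pmf" where
  "local_resample I X R =
     bind_pmf (Pi_pmf R undefined (gm_phi_v I)) (\<lambda>Y.
       let X' = (\<lambda>v. if v \<in> R then Y v else X v) in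
       bind_pmf (Pi_pmf (incident_cons I R) False
           (\<lambda>e. bernoulli_pmf (1 - kappa I X R e * gm_phi_c I e (restrict X' e)))) (\<lambda>F.
         return_pmf (X', \<Union>{e \<in> incident_cons I R. F e})))"

text \<open>The while loop, instrumented with two counters: \<open>t\<close> counts iterations, \<open>n\<close> counts
  individual samplings (one per variable of \<open>R\<close> and one per indicator).  The mass that the
  resulting subprobability distribution assigns to \<open>None\<close> is the probability of nontermination.\<close>

partial_function (spmf) sampler_loop ::
    "'v graphical_model \<Rightarrow> ('v \<Rightarrow> nat) \<Rightarrow> 'v set \<Rightarrow> nat \<Rightarrow> nat \<Rightarrow> (('v \<Rightarrow> nat) \<times> nat \<times> nat) spmf"
  where
  "sampler_loop I X R t n =
     (if R = {} then return_spmf (X, t, n)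
      else bind_spmf (spmf_of_pmf (local_resample I X R)) (\<lambda>(X', R').
        sampler_loop I X' R' (t + 1) (n + card R + card (incident_cons I R))))"

definition dynamic_sampler ::
    "'v graphical_model \<Rightarrow> ('v \<Rightarrow> nat) \<Rightarrow> 'v gm_update \<Rightarrow> (('v \<Rightarrow> nat) \<times> nat \<times> nat) spmf" where
  "dynamic_sampler I X U = sampler_loop (apply_update I U) X (vbl (upd_set U)) 0 0"

text \<open>The sampler run on a random input drawn from \<open>\<mu>\<close>.\<close>

definition sampler_run ::
    "'v graphical_model \<Rightarrow> ('v \<Rightarrow> nat) pmf \<Rightarrow> 'v gm_update \<Rightarrow> (('v \<Rightarrow> nat) \<times> nat \<times> nat) spmf" where
  "sampler_run I \<mu> U = bind_pmf \<mu> (\<lambda>X. dynamic_sampler I X U)"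

text \<open>Nonterminating runs count as infinite.\<close>

definition expected_iterations :: "('x \<times> nat \<times> nat) spmf \<Rightarrow> ennreal" where
  "expected_iterations P =
     (\<integral>\<^sup>+\<omega>. (case \<omega> of None \<Rightarrow> \<infinity> | Some (_, t, _) \<Rightarrow> of_nat t) \<partial>measure_pmf P)"

definition expected_resamplings :: "('x \<times> nat \<times> nat) spmf \<Rightarrow> ennreal" where
  "expected_resamplings P =
     (\<integral>\<^sup>+\<omega>. (case \<omega> of None \<Rightarrow> \<infinity> | Some (_, _, n) \<Rightarrow> of_nat n) \<partial>measure_pmf P)"

end

theory Submission
  imports Defs
begin

text \<open>
  Measure a region \<open>R\<close> by the least number of variables and constraints that cover it. Constraints
  sharing a variable are adjacent in the dependency graph, so a region of size \<open>s\<close> meets at most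
  \<open>(d + 1) s\<close> constraints. Each of them fails with probability at most
  \<open>1 - B\<^sub>e\<^sup>2 \<le> (1 - \<delta>) / (d + 1)\<close>, and the failed constraints cover the next region. Hence the
  expected size shrinks by the factor \<open>1 - \<delta>\<close> in every round. The probability that the loop
  survives \<open>k\<close> rounds is therefore at most \<open>min 1 (s (1 - \<delta>)\<^sup>k)\<close>, and the sum of these bounds,
  which dominates the expected number of iterations, is logarithmic in \<open>s\<close>. For bounded degree
  and arity the cost of a round is linear in the size, so the expected total cost is a geometric
  series.
\<close>

subsection \<open>Geometric decay capped at one\<close>

lemma summable_min_one_geometric:
  fixes r y :: real
  assumes "0 \<le> r" "r < 1" "0 \<le> y"
  shows "summable (\<lambda>k. min 1 (y * r ^ k))"
  by (rule summable_comparison_test'[where g = "\<lambda>k. y * r ^ k"])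
    (use assms in \<open>auto intro!: summable_mult summable_geometric\<close>)

lemma suminf_min_one_geometric_le:
  fixes r y :: real
  assumes rate: "0 \<le> r" "r < 1" and y_nonneg: "0 \<le> y"
  shows "(\<Sum>k. min 1 (y * r ^ k)) \<le> real m + y * r ^ m / (1 - r)"
proof -
  have geometric: "(\<lambda>k. y * r ^ (k + m)) sums (y * r ^ m / (1 - r))"
    using sums_mult[OF geometric_sums[of r], of "y * r ^ m"] rate by (simp add: power_add mult_ac)
  note summable = summable_min_one_geometric[OF rate y_nonneg]
  have "(\<Sum>k. min 1 (y * r ^ k))
      = (\<Sum>k. min 1 (y * r ^ (k + m))) + (\<Sum>k<m. min 1 (y * r ^ k))"
    by (rule suminf_split_initial_segment[OF summable])
  also have "(\<Sum>k. min 1 (y * r ^ (k + m))) \<le> (\<Sum>k. y * r ^ (k + m))"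
    using summable_ignore_initial_segment[OF summable] sums_summable[OF geometric]
    by (intro suminf_le) auto
  also have "\<dots> = y * r ^ m / (1 - r)"
    by (rule sums_unique[OF geometric, symmetric])
  also have "(\<Sum>k<m. min 1 (y * r ^ k)) \<le> real m"
    using sum_bounded_above[of "{..<m}" "\<lambda>k. min 1 (y * r ^ k)" 1] by simp
  finally show ?thesis by simp
qed

lemma suminf_min_one_geometric_le_ln:
  fixes r y :: real
  assumes rate: "0 \<le> r" "r < 1" and y_nonneg: "0 \<le> y"
  shows "(\<Sum>k. min 1 (y * r ^ k)) \<le> (1 + 1 / (1 - r)) * (1 + max 0 (ln y))"
proof -
  define l where "l = max 0 (ln y)"
  define m where "m = nat \<lceil>l / (1 - r)\<rceil>"
  have l_nonneg: "0 \<le> l" by (simp add: l_def)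
  have "y \<le> exp l"
  proof (cases "y = 0")
    case False
    then have "y = exp (ln y)" using y_nonneg by simp
    also have "\<dots> \<le> exp l" by (simp add: l_def)
    finally show ?thesis .
  qed simp
  have m_bounds: "l / (1 - r) \<le> m" "m \<le> l / (1 - r) + 1"
    using l_nonneg rate unfolding m_def by (auto simp: le_of_int_ceiling)
  have "r ^ m \<le> exp (r - 1) ^ m"
    using rate exp_ge_add_one_self[of "r - 1"] by (intro power_mono) auto
  also have "\<dots> = exp (- (m * (1 - r)))"
    by (simp add: algebra_simps flip: exp_of_nat_mult)
  also have "\<dots> \<le> exp (- l)"
    using m_bounds(1) rate by (simp add: pos_divide_le_eq)
  finally have "y * r ^ m \<le> exp l * exp (- l)"
    using \<open>y \<le> exp l\<close> y_nonneg rate by (intro mult_mono) auto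
  then have "y * r ^ m \<le> 1" by (simp flip: exp_add)
  have "(\<Sum>k. min 1 (y * r ^ k)) \<le> m + y * r ^ m / (1 - r)"
    by (rule suminf_min_one_geometric_le[OF rate y_nonneg])
  also have "\<dots> \<le> (l / (1 - r) + 1) + 1 / (1 - r)"
    using m_bounds(2) \<open>y * r ^ m \<le> 1\<close> rate by (intro add_mono divide_right_mono) auto
  also have "\<dots> \<le> (1 + 1 / (1 - r)) * (1 + l)"
    using l_nonneg by (simp add: algebra_simps add_divide_distrib)
  finally show ?thesis unfolding l_def .
qed

subsection \<open>Covering regions by variables and constraints\<close>

definition scope :: "'v + 'v set \<Rightarrow> 'v set" where
  "scope = case_sum (\<lambda>v. {v}) (\<lambda>e. e)"

lemma vbl_eq_UN_scope: "vbl D = (\<Union>x\<in>D. scope x)"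
  by (force simp: vbl_def scope_def split: sum.splits)

definition is_cover :: "'v graphical_model \<Rightarrow> 'v set \<Rightarrow> ('v + 'v set) set \<Rightarrow> bool" where
  "is_cover J R D \<longleftrightarrow> D \<subseteq> gm_vars J <+> gm_cons J \<and> R \<subseteq> vbl D"

text \<open>A region without a cover has cover number \<open>Inf {} = 0\<close>.\<close>

definition cover_number :: "'v graphical_model \<Rightarrow> 'v set \<Rightarrow> nat" where
  "cover_number J R = (INF D\<in>Collect (is_cover J R). card D)"

lemma cover_number_le_card: "is_cover J R D \<Longrightarrow> cover_number J R \<le> card D"
  unfolding cover_number_def by (rule wellorder_Inf_le1) simp

lemma cover_number_Union_le:
  assumes "T \<subseteq> gm_cons J"
  shows "cover_number J (\<Union>T) \<le> card T"
proof -
  have "is_cover J (\<Union>T) (Inr ` T)"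
    using assms by (auto simp: is_cover_def vbl_def)
  from cover_number_le_card[OF this] show ?thesis by (simp add: card_image)
qed

lemma minimal_coverE:
  assumes "R \<subseteq> gm_vars J"
  obtains D where "is_cover J R D" "card D = cover_number J R"
proof -
  have "is_cover J R (Inl ` R)"
    using assms by (auto simp: is_cover_def vbl_def)
  then have "cover_number J R \<in> card ` Collect (is_cover J R)"
    unfolding cover_number_def by (intro Inf_nat_def1) auto
  then show thesis using that by auto
qed

subsection \<open>Incidence in a graphical model\<close>

locale valid_model =
  fixes J :: "'v graphical_model"
  assumes valid: "is_graphical_model J"
begin

lemma finite_vars: "finite (gm_vars J)"
  using valid by (simp add: is_graphical_model_def)

lemma cons_subset_vars: "e \<in> gm_cons J \<Longrightarrow> e \<subseteq> gm_vars J"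
  using valid by (auto simp: is_graphical_model_def)

lemma cons_nonempty: "e \<in> gm_cons J \<Longrightarrow> e \<noteq> {}"
  using valid by (force simp: is_graphical_model_def)

lemma finite_cons: "finite (gm_cons J)"
  by (rule finite_subset[of _ "Pow (gm_vars J)"]) (use cons_subset_vars finite_vars in auto)

lemma finite_constraint: "e \<in> gm_cons J \<Longrightarrow> finite e"
  using cons_subset_vars finite_vars finite_subset by blast

lemma finite_cover: "is_cover J R D \<Longrightarrow> finite D"
  using finite_subset[of D "gm_vars J <+> gm_cons J"] finite_vars finite_cons
  by (simp add: is_cover_def)

lemma incident_cons_eq: "incident_cons J S = {e \<in> gm_cons J. e \<inter> S \<noteq> {}}"
  using cons_nonempty by (auto simp: incident_cons_def internal_cons_def boundary_cons_def)

lemma finite_incident_cons: "finite (incident_cons J S)"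
  by (simp add: incident_cons_eq finite_cons)

lemma card_incident_cons_le_degree:
  assumes "e \<in> gm_cons J" "S \<subseteq> e"
  shows "card (incident_cons J S) \<le> max_dep_degree J + 1"
proof -
  have finite: "finite (dep_neighbours J e)"
    by (simp add: dep_neighbours_def finite_cons)
  have "incident_cons J S \<subseteq> insert e (dep_neighbours J e)"
    using assms(2) by (auto simp: incident_cons_eq dep_neighbours_def)
  then have "card (incident_cons J S) \<le> card (insert e (dep_neighbours J e))"
    using finite by (simp add: card_mono)
  also have "\<dots> \<le> card (dep_neighbours J e) + 1"
    using finite by (simp add: card_insert_if)
  also have "card (dep_neighbours J e) \<le> max_dep_degree J"
    unfolding max_dep_degree_def using assms(1) finite_cons by (intro Max_ge) auto
  finally show ?thesis by simp
qed

lemma card_incident_cons_scope_le: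
  assumes "x \<in> gm_vars J <+> gm_cons J"
  shows "card (incident_cons J (scope x)) \<le> max_dep_degree J + 1"
proof (cases "incident_cons J (scope x) = {}")
  case False
  with assms have "\<exists>e\<in>gm_cons J. scope x \<subseteq> e"
    by (cases x) (auto simp: incident_cons_eq scope_def)
  then show ?thesis using card_incident_cons_le_degree by blast
qed simp

lemma card_le_mult_cover_number:
  assumes region: "R \<subseteq> gm_vars J"
    and covered: "\<And>D. R \<subseteq> (\<Union>x\<in>D. scope x) \<Longrightarrow> A \<subseteq> (\<Union>x\<in>D. S x)"
    and finite_pieces: "\<And>x. x \<in> gm_vars J <+> gm_cons J \<Longrightarrow> finite (S x)"
    and card_pieces: "\<And>x. x \<in> gm_vars J <+> gm_cons J \<Longrightarrow> card (S x) \<le> k"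
  shows "card A \<le> k * cover_number J R"
proof -
  obtain D where minimal: "is_cover J R D" "card D = cover_number J R"
    using minimal_coverE[OF region] .
  have items: "x \<in> gm_vars J <+> gm_cons J" if "x \<in> D" for x
    using minimal(1) that by (auto simp: is_cover_def)
  have "A \<subseteq> (\<Union>x\<in>D. S x)"
    using minimal(1) by (intro covered) (simp add: is_cover_def vbl_eq_UN_scope)
  then have "card A \<le> card (\<Union>x\<in>D. S x)"
    using finite_pieces items finite_cover[OF minimal(1)]
    by (intro card_mono finite_UN_I) simp_all
  also have "\<dots> \<le> (\<Sum>x\<in>D. card (S x))"
    by (rule card_UN_le[OF finite_cover[OF minimal(1)]])
  also have "\<dots> \<le> k * cover_number J R"
    using sum_bounded_above[of D "\<lambda>x. card (S x)" k] card_pieces items minimal(2)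
    by (simp add: mult.commute)
  finally show ?thesis .
qed

lemma card_incident_cons_le_cover_number:
  assumes "R \<subseteq> gm_vars J"
  shows "card (incident_cons J R) \<le> (max_dep_degree J + 1) * cover_number J R"
  using assms
proof (rule card_le_mult_cover_number)
  show "incident_cons J R \<subseteq> (\<Union>x\<in>D. incident_cons J (scope x))"
    if "R \<subseteq> (\<Union>x\<in>D. scope x)" for D
    using that unfolding incident_cons_eq by blast
qed (simp_all only: finite_incident_cons card_incident_cons_scope_le)

lemma card_le_cover_number:
  assumes "R \<subseteq> gm_vars J" and "\<forall>e\<in>gm_cons J. card e \<le> L"
  shows "card R \<le> max 1 L * cover_number J R"
  using assms(1)
  by (rule card_le_mult_cover_number[where S = scope])
    (use assms(2) finite_constraint in \<open>auto simp: scope_def le_max_iff_disj\<close>)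

lemma cover_number_pos:
  assumes "R \<subseteq> gm_vars J" "R \<noteq> {}"
  shows "1 \<le> cover_number J R"
proof -
  obtain D where minimal: "is_cover J R D" "card D = cover_number J R"
    using minimal_coverE[OF assms(1)] .
  then have "D \<noteq> {}"
    using assms(2) by (auto simp: is_cover_def vbl_def)
  then show ?thesis
    using finite_cover[OF minimal(1)] by (simp add: Suc_leI card_gt_0_iff flip: minimal(2))
qed

end

subsection \<open>One round of resampling\<close>

definition configurations :: "'v graphical_model \<Rightarrow> ('v \<Rightarrow> nat) set" where
  "configurations J = gm_vars J \<rightarrow> {1..gm_q J}"

definition sampler_states :: "'v graphical_model \<Rightarrow> (('v \<Rightarrow> nat) \<times> 'v set) set" where
  "sampler_states J = configurations J \<times> Pow (gm_vars J)"

definition failure_prob ::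
    "'v graphical_model \<Rightarrow> ('v \<Rightarrow> nat) \<Rightarrow> 'v set \<Rightarrow> ('v \<Rightarrow> nat) \<Rightarrow> 'v set \<Rightarrow> real" where
  "failure_prob J X R X' e = 1 - kappa J X R e * gm_phi_c J e (restrict X' e)"

definition failed_cons_pmf ::
    "'v graphical_model \<Rightarrow> ('v \<Rightarrow> nat) \<Rightarrow> 'v set \<Rightarrow> ('v \<Rightarrow> nat) \<Rightarrow> 'v set set pmf" where
  "failed_cons_pmf J X R X' = map_pmf (\<lambda>F. {e \<in> incident_cons J R. F e})
     (Pi_pmf (incident_cons J R) False (\<lambda>e. bernoulli_pmf (failure_prob J X R X' e)))"

lemma local_resample_eq:
  "local_resample J X R = bind_pmf (Pi_pmf R undefined (gm_phi_v J)) (\<lambda>Y.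
     map_pmf (\<lambda>T. (override_on X Y R, \<Union>T)) (failed_cons_pmf J X R (override_on X Y R)))"
  by (simp add: local_resample_def failed_cons_pmf_def failure_prob_def override_on_def Let_def
      map_pmf_def bind_assoc_pmf bind_return_pmf)

lemma nn_integral_card_Pi_pmf:
  fixes p :: "'a \<Rightarrow> bool pmf"
  assumes "finite A"
  shows "(\<integral>\<^sup>+F. of_nat (card {x \<in> A. F x}) \<partial>Pi_pmf A dflt p) = (\<Sum>x\<in>A. ennreal (pmf (p x) True))"
proof -
  have count: "of_nat (card {x \<in> A. F x}) = (\<Sum>x\<in>A. indicator {True} (F x) :: ennreal)" for F
    using assms by (simp add: indicator_def sum.If_cases Int_def)
  have marginal: "(\<integral>\<^sup>+F. indicator {True} (F x) \<partial>Pi_pmf A dflt p) = ennreal (pmf (p x) True)"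
    if "x \<in> A" for x
  proof -
    have "(\<integral>\<^sup>+F. indicator {True} (F x) \<partial>Pi_pmf A dflt p)
        = (\<integral>\<^sup>+b. indicator {True} b \<partial>map_pmf (\<lambda>F. F x) (Pi_pmf A dflt p))"
      by simp
    also have "map_pmf (\<lambda>F. F x) (Pi_pmf A dflt p) = p x"
      using Pi_pmf_component[OF assms, of x dflt p] that by simp
    finally show ?thesis by (simp add: emeasure_pmf_single)
  qed
  show ?thesis by (simp add: count nn_integral_sum marginal)
qed

context valid_model
begin

lemma restrict_in_assignments:
  "X \<in> configurations J \<Longrightarrow> e \<in> gm_cons J \<Longrightarrow> restrict X e \<in> assignments J e"
  using cons_subset_vars by (fastforce simp: configurations_def assignments_def)

lemma override_on_in_configurations:
  assumes config: "X \<in> configurations J" and region: "R \<subseteq> gm_vars J"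
    and resampled: "Y \<in> set_pmf (Pi_pmf R undefined (gm_phi_v J))"
  shows "override_on X Y R \<in> configurations J"
proof -
  have "finite R" using region finite_vars finite_subset by blast
  then have "Y v \<in> set_pmf (gm_phi_v J v)" if "v \<in> R" for v
    using resampled that by (auto simp: set_Pi_pmf PiE_dflt_def)
  then have "Y v \<in> {1..gm_q J}" if "v \<in> R" for v
    using valid region that unfolding is_graphical_model_def by blast
  then show ?thesis
    using config unfolding configurations_def Pi_iff override_on_def by simp
qed

lemma set_failed_cons_pmf_subset: "T \<in> set_pmf (failed_cons_pmf J X R X') \<Longrightarrow> T \<subseteq> gm_cons J"
  by (auto simp: failed_cons_pmf_def incident_cons_eq)

lemma set_local_resample_subset:
  assumes "(X, R) \<in> sampler_states J"
  shows "set_pmf (local_resample J X R) \<subseteq> sampler_states J"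
proof
  fix s assume "s \<in> set_pmf (local_resample J X R)"
  then obtain Y T where "Y \<in> set_pmf (Pi_pmf R undefined (gm_phi_v J))"
      and failed: "T \<in> set_pmf (failed_cons_pmf J X R (override_on X Y R))"
      and s_eq: "s = (override_on X Y R, \<Union>T)"
    by (auto simp: local_resample_eq)
  then have "override_on X Y R \<in> configurations J"
    using assms by (intro override_on_in_configurations) (auto simp: sampler_states_def)
  moreover have "\<Union>T \<subseteq> gm_vars J"
    using set_failed_cons_pmf_subset[OF failed] cons_subset_vars by blast
  ultimately show "s \<in> sampler_states J"
    by (simp add: s_eq sampler_states_def)
qed

lemma nn_integral_local_resample_mono:
  assumes "(X, R) \<in> sampler_states J"
    and "\<And>X' R'. (X', R') \<in> sampler_states J \<Longrightarrow> f (X', R') \<le> g (X', R')"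
  shows "(\<integral>\<^sup>+s. f s \<partial>local_resample J X R) \<le> (\<integral>\<^sup>+s. g s \<partial>local_resample J X R)"
  using set_local_resample_subset[OF assms(1)] assms(2)
  by (intro nn_integral_mono_AE) (auto simp: AE_measure_pmf_iff)

end

locale soft_model = valid_model J for J :: "'v graphical_model" +
  fixes B :: "'v set \<Rightarrow> real"
  assumes lower_bound_pos: "e \<in> gm_cons J \<Longrightarrow> 0 < B e"
    and phi_bounds: "e \<in> gm_cons J \<Longrightarrow> x \<in> assignments J e \<Longrightarrow> gm_phi_c J e x \<in> {B e..1}"
begin

lemma kappa_bounds:
  assumes config: "X \<in> configurations J" and cons: "e \<in> gm_cons J"
  shows "kappa J X R e \<in> {B e..1}"
proof -
  define A where "A = gm_phi_c J e `
      {x \<in> assignments J e. restrict x (e \<inter> R) = restrict X (e \<inter> R)}"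
  define p where "p = gm_phi_c J e (restrict X e)"
  have "finite (assignments J e)"
    unfolding assignments_def using finite_constraint[OF cons] by (intro finite_PiE) auto
  then have "finite A" by (simp add: A_def)
  have "p \<in> A"
    unfolding A_def p_def using restrict_in_assignments[OF config cons]
    by (intro imageI) (auto simp: restrict_def fun_eq_iff)
  have A_bounds: "A \<subseteq> {B e..1}"
    using phi_bounds[OF cons] by (auto simp: A_def)
  have "0 < B e" by (rule lower_bound_pos[OF cons])
  then have "0 < p" "p \<le> 1" using A_bounds \<open>p \<in> A\<close> by auto
  have "Min A \<le> p" using \<open>finite A\<close> \<open>p \<in> A\<close> by simp
  have "Min A \<in> A" using \<open>finite A\<close> \<open>p \<in> A\<close> by (intro Min_in) auto
  then have "B e \<le> Min A" using A_bounds by auto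
  moreover have "B e * p \<le> B e"
    using \<open>p \<le> 1\<close> \<open>0 < B e\<close> by (simp add: mult_left_le)
  ultimately have "B e * p \<le> Min A" by simp
  moreover have "kappa J X R e = Min A / p"
    using \<open>0 < p\<close> by (simp add: kappa_def Let_def A_def p_def)
  ultimately show ?thesis
    using \<open>Min A \<le> p\<close> \<open>0 < p\<close> by (simp add: pos_le_divide_eq)
qed

lemma failure_prob_bounds:
  assumes config: "X \<in> configurations J" and resampled: "X' \<in> configurations J"
    and cons: "e \<in> gm_cons J"
  shows "failure_prob J X R X' e \<in> {0..1 - (B e)\<^sup>2}"
proof -
  let ?\<phi> = "gm_phi_c J e (restrict X' e)"
  note bounds = lower_bound_pos[OF cons] kappa_bounds[OF config cons, of R]
    phi_bounds[OF cons restrict_in_assignments[OF resampled cons]]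
  have "B e * B e \<le> kappa J X R e * ?\<phi>"
    using bounds by (intro mult_mono) auto
  moreover have "kappa J X R e * ?\<phi> \<le> 1"
    using bounds by (intro mult_le_one) auto
  ultimately show ?thesis by (simp add: failure_prob_def power2_eq_square)
qed

lemma expected_card_failed_cons_le:
  assumes "X \<in> configurations J" "X' \<in> configurations J"
  shows "(\<integral>\<^sup>+T. of_nat (card T) \<partial>failed_cons_pmf J X R X')
    \<le> ennreal (\<Sum>e\<in>incident_cons J R. 1 - (B e)\<^sup>2)"
proof -
  have bounds: "failure_prob J X R X' e \<in> {0..1 - (B e)\<^sup>2}" if "e \<in> incident_cons J R" for e
    using failure_prob_bounds[OF assms] that by (simp add: incident_cons_eq)
  have prob: "failure_prob J X R X' e \<in> {0..1}" if "e \<in> incident_cons J R" for e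
    using bounds[OF that] zero_le_power2[of "B e"] unfolding atLeastAtMost_iff by linarith
  have "(\<integral>\<^sup>+T. of_nat (card T) \<partial>failed_cons_pmf J X R X')
      = (\<Sum>e\<in>incident_cons J R. ennreal (pmf (bernoulli_pmf (failure_prob J X R X' e)) True))"
    unfolding failed_cons_pmf_def nn_integral_map_pmf
    by (rule nn_integral_card_Pi_pmf[OF finite_incident_cons])
  also have "\<dots> = (\<Sum>e\<in>incident_cons J R. ennreal (failure_prob J X R X' e))"
    using prob by (intro sum.cong) auto
  also have "\<dots> = ennreal (\<Sum>e\<in>incident_cons J R. failure_prob J X R X' e)"
    using prob by (intro sum_ennreal) auto
  also have "\<dots> \<le> ennreal (\<Sum>e\<in>incident_cons J R. 1 - (B e)\<^sup>2)"
    using bounds by (intro ennreal_leI sum_mono) auto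
  finally show ?thesis .
qed

end

locale contracting_model = soft_model J B for J :: "'v graphical_model" and B +
  fixes r :: real
  assumes rate_nonneg: "0 \<le> r" and rate_less_1: "r < 1"
    and failure_rate: "e \<in> gm_cons J \<Longrightarrow> 1 - (B e)\<^sup>2 \<le> r / (real (max_dep_degree J) + 1)"
begin

lemma sum_failure_rate_le:
  assumes "R \<subseteq> gm_vars J"
  shows "(\<Sum>e\<in>incident_cons J R. 1 - (B e)\<^sup>2) \<le> r * real (cover_number J R)"
proof -
  let ?d = "max_dep_degree J + 1"
  have "(\<Sum>e\<in>incident_cons J R. 1 - (B e)\<^sup>2) \<le> real (card (incident_cons J R)) * (r / ?d)"
    using failure_rate by (intro sum_bounded_above) (simp add: incident_cons_eq add.commute)
  also have "\<dots> \<le> real (?d * cover_number J R) * (r / ?d)"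
    using rate_nonneg
    by (intro mult_right_mono of_nat_mono card_incident_cons_le_cover_number assms) simp
  also have "\<dots> = r * real (cover_number J R)"
    by (simp add: field_simps)
  finally show ?thesis .
qed

lemma expected_cover_number_local_resample_le:
  assumes "(X, R) \<in> sampler_states J"
  shows "(\<integral>\<^sup>+s. of_nat (cover_number J (snd s)) \<partial>local_resample J X R)
    \<le> ennreal r * of_nat (cover_number J R)"
proof -
  have config: "X \<in> configurations J" and region: "R \<subseteq> gm_vars J"
    using assms by (auto simp: sampler_states_def)
  have failed: "(\<integral>\<^sup>+T. of_nat (cover_number J (\<Union>T)) \<partial>failed_cons_pmf J X R (override_on X Y R))
      \<le> ennreal (r * real (cover_number J R))"
    if resampled: "Y \<in> set_pmf (Pi_pmf R undefined (gm_phi_v J))" for Y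
  proof -
    have "(\<integral>\<^sup>+T. of_nat (cover_number J (\<Union>T)) \<partial>failed_cons_pmf J X R (override_on X Y R))
        \<le> (\<integral>\<^sup>+T. of_nat (card T) \<partial>failed_cons_pmf J X R (override_on X Y R))"
      by (intro nn_integral_mono_AE)
        (simp add: AE_measure_pmf_iff cover_number_Union_le set_failed_cons_pmf_subset)
    also have "\<dots> \<le> ennreal (\<Sum>e\<in>incident_cons J R. 1 - (B e)\<^sup>2)"
      by (intro expected_card_failed_cons_le config
          override_on_in_configurations[OF config region resampled])
    also have "\<dots> \<le> ennreal (r * real (cover_number J R))"
      by (intro ennreal_leI sum_failure_rate_le region)
    finally show ?thesis .
  qed
  have "(\<integral>\<^sup>+s. of_nat (cover_number J (snd s)) \<partial>local_resample J X R)
      = (\<integral>\<^sup>+Y. \<integral>\<^sup>+T. of_nat (cover_number J (\<Union>T)) \<partial>failed_cons_pmf J X R (override_on X Y R)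
          \<partial>Pi_pmf R undefined (gm_phi_v J))"
    by (simp add: local_resample_eq)
  also have "\<dots> \<le> (\<integral>\<^sup>+Y. ennreal (r * real (cover_number J R)) \<partial>Pi_pmf R undefined (gm_phi_v J))"
    by (intro nn_integral_mono_AE) (simp add: AE_measure_pmf_iff failed)
  finally show ?thesis
    using rate_nonneg by (simp add: ennreal_mult ennreal_of_nat_eq_real_of_nat)
qed

end

subsection \<open>The loop\<close>

text \<open>Unlike the loop, this does not stop at the empty region; sums of costs over the rounds
  still bound those of the loop from above.\<close>

primrec resample_rounds ::
    "'v graphical_model \<Rightarrow> nat \<Rightarrow> ('v \<Rightarrow> nat) \<Rightarrow> 'v set \<Rightarrow> (('v \<Rightarrow> nat) \<times> 'v set) pmf" where
  "resample_rounds J 0 X R = return_pmf (X, R)"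
| "resample_rounds J (Suc k) X R =
     bind_pmf (local_resample J X R) (\<lambda>s. resample_rounds J k (fst s) (snd s))"

definition counter :: "(nat \<Rightarrow> nat \<Rightarrow> nat) \<Rightarrow> ('x \<times> nat \<times> nat) option \<Rightarrow> ennreal" where
  "counter f \<omega> = (case \<omega> of None \<Rightarrow> \<infinity> | Some (_, t, n) \<Rightarrow> of_nat (f t n))"

lemma SUP_min_of_nat_add:
  fixes a :: nat and x :: ennreal
  shows "(SUP k. min x (of_nat (a + k))) = x"
proof -
  have "(SUP k. of_nat (a + k) :: ennreal) = top"
    using ennreal_SUP_of_nat_eq_top by (simp add: ennreal_SUP_add_right[symmetric])
  then show ?thesis by (simp only: inf_min[symmetric] inf_SUP[symmetric] inf_top_right)
qed

lemma sampler_loop_empty: "sampler_loop J X {} t n = return_spmf (X, t, n)"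
  by (subst sampler_loop.simps) simp

lemma nn_integral_sampler_loop_step:
  assumes "R \<noteq> {}"
  shows "(\<integral>\<^sup>+\<omega>. f \<omega> \<partial>sampler_loop J X R t n)
    = (\<integral>\<^sup>+s. (\<integral>\<^sup>+\<omega>. f \<omega> \<partial>sampler_loop J (fst s) (snd s) (t + 1)
          (n + card R + card (incident_cons J R))) \<partial>local_resample J X R)"
  using assms by (subst sampler_loop.simps) (simp add: case_prod_beta)

context valid_model
begin

lemma set_resample_rounds_subset:
  assumes "(X, R) \<in> sampler_states J"
  shows "set_pmf (resample_rounds J k X R) \<subseteq> sampler_states J"
  using assms
proof (induction k arbitrary: X R)
  case (Suc k)
  have "set_pmf (resample_rounds J k (fst s) (snd s)) \<subseteq> sampler_states J"
    if "s \<in> set_pmf (local_resample J X R)" for s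
    using set_local_resample_subset[OF Suc.prems] that by (intro Suc.IH) auto
  then show ?case by auto
qed simp

context
  fixes f :: "nat \<Rightarrow> nat \<Rightarrow> nat" and c :: "'v set \<Rightarrow> nat"
  assumes counter_step: "R \<noteq> {} \<Longrightarrow>
      f (t + 1) (n + card R + card (incident_cons J R)) = f t n + c R"
    and cost_pos: "R \<subseteq> gm_vars J \<Longrightarrow> R \<noteq> {} \<Longrightarrow> 1 \<le> c R"
begin

lemma expected_truncated_counter_step:
  fixes t n :: nat
  assumes "(X, R) \<in> sampler_states J" and "R \<noteq> {}"
  defines "n' \<equiv> n + card R + card (incident_cons J R)"
  shows "(\<integral>\<^sup>+\<omega>. min (counter f \<omega>) (of_nat (f t n + Suc k)) \<partial>sampler_loop J X R t n)
    \<le> (\<integral>\<^sup>+s. (\<integral>\<^sup>+\<omega>. min (counter f \<omega>) (of_nat (f (t + 1) n' + k))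
        \<partial>sampler_loop J (fst s) (snd s) (t + 1) n') \<partial>local_resample J X R)"
proof -
  have "1 \<le> c R"
    using assms(1,2) by (intro cost_pos) (auto simp: sampler_states_def)
  then have "f t n + Suc k \<le> f (t + 1) n' + k"
    unfolding n'_def counter_step[OF assms(2)] by simp
  then have "min x (of_nat (f t n + Suc k)) \<le> min x (of_nat (f (t + 1) n' + k))" for x :: ennreal
    by (intro min.mono order_refl of_nat_mono)
  then have "(\<integral>\<^sup>+\<omega>. min (counter f \<omega>) (of_nat (f t n + Suc k)) \<partial>sampler_loop J X R t n)
      \<le> (\<integral>\<^sup>+\<omega>. min (counter f \<omega>) (of_nat (f (t + 1) n' + k)) \<partial>sampler_loop J X R t n)"
    by (intro nn_integral_mono)
  then show ?thesis
    unfolding n'_def nn_integral_sampler_loop_step[OF assms(2)] .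
qed

text \<open>
  Every round costs at least one, so the truncation at \<open>f t n + k\<close> is reached within \<open>k\<close> rounds;
  this gives an induction on \<open>k\<close> that does not presuppose termination.
\<close>

lemma expected_truncated_counter_le:
  assumes "(X, R) \<in> sampler_states J"
  shows "(\<integral>\<^sup>+\<omega>. min (counter f \<omega>) (of_nat (f t n + k)) \<partial>sampler_loop J X R t n)
    \<le> of_nat (f t n) + (\<Sum>j<k. \<integral>\<^sup>+s. of_nat (c (snd s)) \<partial>resample_rounds J j X R)"
  using assms
proof (induction k arbitrary: X R t n)
  case 0
  have "(\<integral>\<^sup>+\<omega>. min (counter f \<omega>) (of_nat (f t n + 0)) \<partial>sampler_loop J X R t n)
      \<le> (\<integral>\<^sup>+\<omega>. of_nat (f t n) \<partial>sampler_loop J X R t n)"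
    by (intro nn_integral_mono) simp
  then show ?case by simp
next
  case (Suc k)
  show ?case
  proof (cases "R = {}")
    case True
    then show ?thesis by (simp add: sampler_loop_empty counter_def min.coboundedI1)
  next
    case False
    define n' where "n' = n + card R + card (incident_cons J R)"
    let ?cost = "\<lambda>j X R. \<integral>\<^sup>+s. of_nat (c (snd s)) \<partial>resample_rounds J j X R"
    have "(\<integral>\<^sup>+\<omega>. min (counter f \<omega>) (of_nat (f t n + Suc k)) \<partial>sampler_loop J X R t n)
        \<le> (\<integral>\<^sup>+s. (\<integral>\<^sup>+\<omega>. min (counter f \<omega>) (of_nat (f (t + 1) n' + k))
            \<partial>sampler_loop J (fst s) (snd s) (t + 1) n') \<partial>local_resample J X R)"
      unfolding n'_def by (rule expected_truncated_counter_step[OF Suc.prems False])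
    also have "\<dots> \<le> (\<integral>\<^sup>+s. of_nat (f (t + 1) n') + (\<Sum>j<k. ?cost j (fst s) (snd s))
        \<partial>local_resample J X R)"
      using Suc.IH
      by (intro nn_integral_local_resample_mono[OF Suc.prems]) (simp only: fst_conv snd_conv)
    also have "\<dots> = of_nat (f t n + c R)
        + (\<Sum>j<k. \<integral>\<^sup>+s. ?cost j (fst s) (snd s) \<partial>local_resample J X R)"
      unfolding n'_def counter_step[OF False] by (simp add: nn_integral_add nn_integral_sum)
    also have "\<dots> = of_nat (f t n) + (\<Sum>j<Suc k. ?cost j X R)"
      unfolding sum.lessThan_Suc_shift by (simp add: add.assoc)
    finally show ?thesis .
  qed
qed

lemma expected_counter_le_suminf:
  assumes "(X, R) \<in> sampler_states J"
  shows "(\<integral>\<^sup>+\<omega>. counter f \<omega> \<partial>sampler_loop J X R t n)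
    \<le> of_nat (f t n) + (\<Sum>k. \<integral>\<^sup>+s. of_nat (c (snd s)) \<partial>resample_rounds J k X R)"
proof -
  let ?M = "sampler_loop J X R t n"
  have "(\<integral>\<^sup>+\<omega>. counter f \<omega> \<partial>?M) = (\<integral>\<^sup>+\<omega>. (SUP k. min (counter f \<omega>) (of_nat (f t n + k))) \<partial>?M)"
    by (simp only: SUP_min_of_nat_add)
  also have "\<dots> = (SUP k. \<integral>\<^sup>+\<omega>. min (counter f \<omega>) (of_nat (f t n + k)) \<partial>?M)"
    by (intro nn_integral_monotone_convergence_SUP)
      (auto simp: incseq_def le_fun_def intro: min.coboundedI2)
  also have "\<dots> \<le> of_nat (f t n) + (\<Sum>k. \<integral>\<^sup>+s. of_nat (c (snd s)) \<partial>resample_rounds J k X R)"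
    by (intro SUP_least order.trans[OF expected_truncated_counter_le[OF assms]] add_left_mono
        sum_le_suminf) auto
  finally show ?thesis .
qed

end

end

context contracting_model
begin

lemma expected_cover_number_resample_rounds_le:
  assumes "(X, R) \<in> sampler_states J"
  shows "(\<integral>\<^sup>+s. of_nat (cover_number J (snd s)) \<partial>resample_rounds J k X R)
    \<le> ennreal (r ^ k) * of_nat (cover_number J R)"
  using assms
proof (induction k arbitrary: X R)
  case (Suc k)
  have "(\<integral>\<^sup>+s. of_nat (cover_number J (snd s)) \<partial>resample_rounds J (Suc k) X R)
      \<le> (\<integral>\<^sup>+s. ennreal (r ^ k) * of_nat (cover_number J (snd s)) \<partial>local_resample J X R)"
    using Suc.IH by (simp add: nn_integral_local_resample_mono[OF Suc.prems])
  also have "\<dots> \<le> ennreal (r ^ k) * (ennreal r * of_nat (cover_number J R))"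
    by (simp add: nn_integral_cmult mult_left_mono
        expected_cover_number_local_resample_le[OF Suc.prems])
  also have "\<dots> = ennreal (r ^ Suc k) * of_nat (cover_number J R)"
    using rate_nonneg by (simp add: ennreal_mult mult_ac)
  finally show ?case .
qed simp

lemma expected_cost_resample_rounds_le:
  assumes state: "(X, R) \<in> sampler_states J" and cover: "is_cover J R D"
    and cost_le: "\<And>R. R \<subseteq> gm_vars J \<Longrightarrow> c R \<le> b * cover_number J R"
  shows "(\<integral>\<^sup>+s. of_nat (c (snd s)) \<partial>resample_rounds J k X R)
    \<le> ennreal (real b * real (card D) * r ^ k)"
proof -
  have "c (snd s) \<le> b * cover_number J (snd s)" if "s \<in> set_pmf (resample_rounds J k X R)" for s
    using subsetD[OF set_resample_rounds_subset[OF state] that]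
    by (intro cost_le) (auto simp: sampler_states_def)
  then have "(\<integral>\<^sup>+s. of_nat (c (snd s)) \<partial>resample_rounds J k X R)
      \<le> (\<integral>\<^sup>+s. of_nat (b * cover_number J (snd s)) \<partial>resample_rounds J k X R)"
    by (intro nn_integral_mono_AE) (simp add: AE_measure_pmf_iff flip: of_nat_mult)
  also have "\<dots> \<le> of_nat b * (ennreal (r ^ k) * of_nat (cover_number J R))"
    using expected_cover_number_resample_rounds_le[OF state]
    by (simp add: nn_integral_cmult mult_left_mono)
  also have "\<dots> = ennreal (real b * real (cover_number J R) * r ^ k)"
    using rate_nonneg by (simp add: ennreal_of_nat_eq_real_of_nat ennreal_mult mult_ac)
  also have "\<dots> \<le> ennreal (real b * real (card D) * r ^ k)"
    using rate_nonneg cover_number_le_card[OF cover]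
    by (intro ennreal_leI mult_right_mono mult_left_mono) auto
  finally show ?thesis .
qed

lemma expected_iterations_sampler_loop_le:
  assumes state: "(X, R) \<in> sampler_states J" and cover: "is_cover J R D"
  shows "expected_iterations (sampler_loop J X R 0 0)
    \<le> ennreal ((1 + 1 / (1 - r)) * (1 + ln (card D)))"
proof -
  let ?active = "\<lambda>R. of_bool (R \<noteq> {}) :: nat" and ?y = "real (card D)"
  let ?survival = "\<lambda>k. \<integral>\<^sup>+s. of_nat (?active (snd s)) \<partial>resample_rounds J k X R"
  have survival_le: "?survival k \<le> ennreal (min 1 (?y * r ^ k))" for k
  proof -
    have "?survival k \<le> (\<integral>\<^sup>+s. 1 \<partial>resample_rounds J k X R)"
      by (intro nn_integral_mono) simp
    moreover have "?survival k \<le> ennreal (?y * r ^ k)"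
      using expected_cost_resample_rounds_le[OF state cover, of ?active 1 k] cover_number_pos
      by simp
    ultimately show ?thesis by (simp add: min_def)
  qed
  have "expected_iterations (sampler_loop J X R 0 0)
      = (\<integral>\<^sup>+\<omega>. counter (\<lambda>t n. t) \<omega> \<partial>sampler_loop J X R 0 0)"
    by (simp add: expected_iterations_def counter_def)
  also have "\<dots> \<le> (\<Sum>k. ?survival k)"
    using expected_counter_le_suminf[of "\<lambda>t n. t" ?active X R 0 0] state by simp
  also have "\<dots> \<le> (\<Sum>k. ennreal (min 1 (?y * r ^ k)))"
    by (intro suminf_le survival_le) auto
  also have "\<dots> = ennreal (\<Sum>k. min 1 (?y * r ^ k))"
    using rate_nonneg rate_less_1
    by (intro suminf_ennreal2 summable_min_one_geometric) auto
  also have "\<dots> \<le> ennreal ((1 + 1 / (1 - r)) * (1 + max 0 (ln ?y)))"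
    using rate_nonneg rate_less_1 by (intro ennreal_leI suminf_min_one_geometric_le_ln) auto
  also have "max 0 (ln ?y) = ln ?y"
    by (cases "card D = 0") auto
  finally show ?thesis .
qed

lemma expected_resamplings_sampler_loop_le:
  assumes state: "(X, R) \<in> sampler_states J" and cover: "is_cover J R D"
    and degree: "max_dep_degree J \<le> K" and arity: "\<forall>e\<in>gm_cons J. card e \<le> L"
  shows "expected_resamplings (sampler_loop J X R 0 0)
    \<le> ennreal (real (K + 1 + max 1 L) / (1 - r) * card D)"
proof -
  let ?cost = "\<lambda>R. card R + card (incident_cons J R)" and ?b = "K + 1 + max 1 L"
  let ?y = "real (card D)"
  have cost_le: "?cost R \<le> ?b * cover_number J R" if region: "R \<subseteq> gm_vars J" for R
  proof -
    have "(max_dep_degree J + 1) * cover_number J R \<le> (K + 1) * cover_number J R"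
      using degree by (intro mult_right_mono) auto
    with card_incident_cons_le_cover_number[OF region] card_le_cover_number[OF region arity]
    show ?thesis unfolding add_mult_distrib[of "K + 1"] by linarith
  qed
  have cost_pos: "1 \<le> ?cost R" if "R \<subseteq> gm_vars J" "R \<noteq> {}" for R
    using that finite_subset[OF _ finite_vars] by (simp add: Suc_leI card_gt_0_iff)
  have "expected_resamplings (sampler_loop J X R 0 0)
      = (\<integral>\<^sup>+\<omega>. counter (\<lambda>t n. n) \<omega> \<partial>sampler_loop J X R 0 0)"
    by (simp add: expected_resamplings_def counter_def)
  also have "\<dots> \<le> (\<Sum>k. \<integral>\<^sup>+s. of_nat (?cost (snd s)) \<partial>resample_rounds J k X R)"
    using expected_counter_le_suminf[of "\<lambda>t n. n" ?cost X R 0 0] state cost_pos by simp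
  also have "\<dots> \<le> (\<Sum>k. ennreal (real ?b * ?y * r ^ k))"
    by (intro suminf_le expected_cost_resample_rounds_le[OF state cover] cost_le) auto
  also have "\<dots> = ennreal (\<Sum>k. real ?b * ?y * r ^ k)"
    using rate_nonneg rate_less_1
    by (intro suminf_ennreal2 summable_mult summable_geometric) auto
  also have "(\<Sum>k. real ?b * ?y * r ^ k) = real ?b / (1 - r) * ?y"
    using rate_nonneg rate_less_1 by (simp add: suminf_mult suminf_geometric)
  finally show ?thesis .
qed

end

subsection \<open>Running the sampler on an update\<close>

lemma contracting_modelI:
  fixes \<delta> :: real
  assumes "is_graphical_model J" and \<delta>: "0 < \<delta>" "\<delta> \<le> 1"
    and "\<And>e. e \<in> gm_cons J \<Longrightarrow> 0 < B e"
    and "\<And>e x. e \<in> gm_cons J \<Longrightarrow> x \<in> assignments J e \<Longrightarrow> gm_phi_c J e x \<in> {B e..1}"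
    and B_ge: "\<And>e. e \<in> gm_cons J \<Longrightarrow>
      (1 - (1 - \<delta>) / (real (max_dep_degree J) + 1)) powr (1 / 2) \<le> B e"
  shows "contracting_model J B (1 - \<delta>)"
proof
  fix e assume cons: "e \<in> gm_cons J"
  let ?s = "1 - (1 - \<delta>) / (real (max_dep_degree J) + 1)"
  have "0 \<le> ?s"
    using \<delta> by (simp add: field_simps)
  then have "sqrt ?s \<le> B e"
    using B_ge[OF cons] by (simp add: powr_half_sqrt)
  then have "?s \<le> (B e)\<^sup>2"
    by (rule sqrt_le_D)
  then show "1 - (B e)\<^sup>2 \<le> (1 - \<delta>) / (real (max_dep_degree J) + 1)"
    by linarith
qed (use assms in simp_all)

lemma is_graphical_model_apply_update:
  assumes "is_graphical_model I" "is_update I U"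
  shows "is_graphical_model (apply_update I U)"
  using assms
  unfolding is_graphical_model_def is_update_def apply_update_def assignments_def by auto

lemma is_cover_upd_set:
  assumes "is_update I U"
  shows "is_cover (apply_update I U) (vbl (upd_set U)) (upd_set U)"
proof -
  have "x \<in> gm_vars (apply_update I U) <+> gm_cons (apply_update I U)" if "x \<in> upd_set U" for x
    using assms that by (cases x) (auto simp: is_update_def apply_update_def)
  then show ?thesis by (auto simp: is_cover_def)
qed

lemma initial_state_in_sampler_states:
  assumes "is_update I U" "is_gibbs I \<mu>" "X \<in> set_pmf \<mu>"
  shows "(X, vbl (upd_set U)) \<in> sampler_states (apply_update I U)"
proof -
  have "X \<in> assignments I (gm_vars I)"
    using assms(2,3) by (metis is_gibbs_def pmf_eq_0_set_pmf)
  with assms(1) show ?thesis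
    by (auto simp: sampler_states_def configurations_def assignments_def apply_update_def
        is_update_def vbl_def)
qed

lemma nn_integral_sampler_run_le:
  assumes "\<And>X. X \<in> set_pmf \<mu> \<Longrightarrow> (\<integral>\<^sup>+\<omega>. f \<omega> \<partial>dynamic_sampler I X U) \<le> b"
  shows "(\<integral>\<^sup>+\<omega>. f \<omega> \<partial>sampler_run I \<mu> U) \<le> b"
proof -
  have "(\<integral>\<^sup>+\<omega>. f \<omega> \<partial>sampler_run I \<mu> U)
      = (\<integral>\<^sup>+X. \<integral>\<^sup>+\<omega>. f \<omega> \<partial>dynamic_sampler I X U \<partial>\<mu>)"
    by (simp add: sampler_run_def)
  also have "\<dots> \<le> (\<integral>\<^sup>+X. b \<partial>\<mu>)"
    by (intro nn_integral_mono_AE) (simp add: AE_measure_pmf_iff assms)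
  finally show ?thesis by simp
qed

lemma expected_iterations_sampler_run_le:
  "(\<And>X. X \<in> set_pmf \<mu> \<Longrightarrow> expected_iterations (dynamic_sampler I X U) \<le> b) \<Longrightarrow>
    expected_iterations (sampler_run I \<mu> U) \<le> b"
  unfolding expected_iterations_def by (rule nn_integral_sampler_run_le)

lemma expected_resamplings_sampler_run_le:
  "(\<And>X. X \<in> set_pmf \<mu> \<Longrightarrow> expected_resamplings (dynamic_sampler I X U) \<le> b) \<Longrightarrow>
    expected_resamplings (sampler_run I \<mu> U) \<le> b"
  unfolding expected_resamplings_def by (rule nn_integral_sampler_run_le)

theorem theorem2:
  fixes \<delta> :: real
  assumes "0 < \<delta>" and "\<delta> < 1"
  shows "\<exists>(C :: real) (C' :: nat \<Rightarrow> nat \<Rightarrow> real).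
    \<forall>(I :: 'v graphical_model) (U :: 'v gm_update) (\<mu> :: ('v \<Rightarrow> nat) pmf)
      (I' :: 'v graphical_model) (B :: 'v set \<Rightarrow> real).
      is_graphical_model I \<longrightarrow> is_update I U \<longrightarrow> I' = apply_update I U \<longrightarrow> is_gibbs I \<mu> \<longrightarrow>
      (\<forall>e\<in>gm_cons I'. 0 < B e \<and> B e \<le> 1 \<and>
         (\<forall>x\<in>assignments I' e. gm_phi_c I' e x \<in> {B e..1})) \<longrightarrow>
      (\<forall>e\<in>gm_cons I'.
         B e \<ge> (1 - (1 - \<delta>) / (real (max_dep_degree I') + 1)) powr (1 / 2)) \<longrightarrow>
      expected_iterations (sampler_run I \<mu> U)
        \<le> ennreal (C * (1 + ln (real (card (upd_set U))))) \<and>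
      (\<forall>K L. max_dep_degree I' \<le> K \<longrightarrow> (\<forall>e\<in>gm_cons I'. card e \<le> L) \<longrightarrow>
         expected_resamplings (sampler_run I \<mu> U)
           \<le> ennreal (C' K L * real (card (upd_set U))))"
proof (rule exI[of _ "1 + 1 / \<delta>"], rule exI[of _ "\<lambda>K L. real (K + 1 + max 1 L) / \<delta>"],
    intro allI impI conjI)
  fix I :: "'v graphical_model" and U :: "'v gm_update" and \<mu> :: "('v \<Rightarrow> nat) pmf"
    and I' :: "'v graphical_model" and B :: "'v set \<Rightarrow> real"
  assume model: "is_graphical_model I" and update: "is_update I U"
    and updated: "I' = apply_update I U" and gibbs: "is_gibbs I \<mu>"
    and bounds: "\<forall>e\<in>gm_cons I'. 0 < B e \<and> B e \<le> 1 \<and>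
         (\<forall>x\<in>assignments I' e. gm_phi_c I' e x \<in> {B e..1})"
    and rate: "\<forall>e\<in>gm_cons I'.
         B e \<ge> (1 - (1 - \<delta>) / (real (max_dep_degree I') + 1)) powr (1 / 2)"
  interpret contracting_model I' B "1 - \<delta>"
    using assms bounds rate is_graphical_model_apply_update[OF model update, folded updated]
    by (intro contracting_modelI) auto
  have cover: "is_cover I' (vbl (upd_set U)) (upd_set U)"
    unfolding updated by (rule is_cover_upd_set[OF update])
  note state = initial_state_in_sampler_states[OF update gibbs, folded updated]
  show "expected_iterations (sampler_run I \<mu> U)
      \<le> ennreal ((1 + 1 / \<delta>) * (1 + ln (real (card (upd_set U)))))"
    using expected_iterations_sampler_loop_le[OF state cover]
    by (intro expected_iterations_sampler_run_le) (simp add: dynamic_sampler_def updated)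
  fix K L
  assume degree: "max_dep_degree I' \<le> K" and arity: "\<forall>e\<in>gm_cons I'. card e \<le> L"
  show "expected_resamplings (sampler_run I \<mu> U)
      \<le> ennreal (real (K + 1 + max 1 L) / \<delta> * real (card (upd_set U)))"
    using expected_resamplings_sampler_loop_le[OF state cover degree arity]
    by (intro expected_resamplings_sampler_run_le) (simp add: dynamic_sampler_def updated)
qed

end
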